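(* Fix a positive integer $j$ and nonnegative integers $m,d$. Let $g(x)=\sum_P x^{\mathrm{size}(P)}$, the sum over all $(j,m,d)$-$U$-$D$ paths $P$. Then \[ \Phi\big(g(x)\big)=\sum_P x^{\mathrm{size}(P)}y^{\mathrm{npa}_j(P)}, \] the sum over all $(j,m,d)$-$U$-$D$ paths, where $\mathrm{npa}_j(P)$ is the number of $j$-nice pyramid ascents of $P$.
   Context: The run transform is $\Phi\big(f(x)\big)=\frac{1-x}{1-xy}\,f\!\left(\frac{x(1-x)}{1-xy}\right)$. Paths are made of $j$-upsteps (each equal to $j$ consecutive unit upsteps $U=(1,1)$) and downsteps $D=(1,-1)$. A $(j,m,d)$-$U$-$D$ path is such a path starting at $(0,m)$, whose lowest point is at level $-d$, and ending on the $x$-axis. Its size is $\lfloor(\text{number of downsteps})/j\rfloor$. Viewing the path as a sequence of unit steps $U,D$: an ascent is a maximal subpath $U^k$ ($k\ge1$); a pyramid is a maximal subpath $U^kD^k$ ($k\ge1$); a pyramid ascent is an ascent that is the first half of a pyramid; it is $j$-nice if it ends at a height (ordinate) divisible by $j$. *)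

theory Defs
  imports Complex_Main "HOL-Computational_Algebra.Formal_Power_Series"
begin

text \<open>
  Power series in \<open>x\<close> and \<open>y\<close> have type \<^typ>\<open>rat fps fps\<close>: the outer variable is \<open>x\<close>, and a
  series in \<open>y\<close> alone is a constant of the outer ring.
\<close>

abbreviation var_x :: "rat fps fps" where
  "var_x \<equiv> fps_X"

abbreviation var_y :: "rat fps fps" where
  "var_y \<equiv> fps_const fps_X"

definition fps_in_x :: "rat fps \<Rightarrow> rat fps fps" where
  "fps_in_x f = Abs_fps (\<lambda>n. fps_const (fps_nth f n))"

definition run_transform :: "rat fps \<Rightarrow> rat fps fps" where
  "run_transform f =
     (1 - var_x) / (1 - var_x * var_y) *
     fps_compose (fps_in_x f) (var_x * (1 - var_x) / (1 - var_x * var_y))"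

lemma run_transform_denominator:
  "(1 - var_x * var_y) * (f / (1 - var_x * var_y)) = f"
proof -
  let ?g = "1 - var_x * var_y"
  have g0: "fps_nth ?g 0 = 1"
    by simp
  hence s: "subdegree ?g = 0" and n: "?g \<noteq> 0"
    by (metis subdegree_eq_0_iff one_neq_zero, metis fps_zero_nth one_neq_zero)
  have "?g * inverse ?g = 1"
    unfolding fps_inverse_def using g0 by (intro fps_right_inverse) (simp add: fps_lr_inverse_starting0)
  hence "?g * (f * inverse ?g) = f"
    by (metis mult.left_commute mult.right_neutral)
  thus ?thesis
    using s n by (simp add: fps_divide_def Let_def)
qed

lemma run_transform_argument:
  "fps_nth (var_x * (1 - var_x) / (1 - var_x * var_y)) 0 = 0"
  using arg_cong[OF run_transform_denominator[of "var_x * (1 - var_x)"], of "\<lambda>h. fps_nth h 0"]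
  by simp

datatype step = U | D

fun step_height :: "step \<Rightarrow> int" where
  "step_height U = 1"
| "step_height D = -1"

definition height :: "nat \<Rightarrow> step list \<Rightarrow> nat \<Rightarrow> int" where
  "height m P i = int m + (\<Sum>s\<leftarrow>take i P. step_height s)"

text \<open>
  A path is represented by its word of unit steps. For \<open>j > 0\<close> its decomposition into
  \<open>j\<close>-upsteps and downsteps is unique, so no path is identified with another.
\<close>

definition jmd_paths :: "nat \<Rightarrow> nat \<Rightarrow> nat \<Rightarrow> step list set" where
  "jmd_paths j m d =
     {P. (\<exists>ss. set ss \<subseteq> {replicate j U, [D]} \<and> P = concat ss)
       \<and> Min (height m P ` {0..length P}) = - int d
       \<and> height m P (length P) = 0}"

definition path_size :: "nat \<Rightarrow> step list \<Rightarrow> nat" where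
  "path_size j P = count_list P D div j"

text \<open>A subpath of \<open>P\<close> is given by the positions \<open>a \<le> b\<close> at which it starts and ends.\<close>

definition subpath :: "step list \<Rightarrow> nat \<Rightarrow> nat \<Rightarrow> step list" where
  "subpath P a b = take (b - a) (drop a P)"

definition maximal_subpath :: "(step list \<Rightarrow> bool) \<Rightarrow> step list \<Rightarrow> nat \<Rightarrow> nat \<Rightarrow> bool" where
  "maximal_subpath Q P a b \<longleftrightarrow>
     a \<le> b \<and> b \<le> length P \<and> Q (subpath P a b) \<and>
     (\<forall>a' b'. a' \<le> a \<and> b \<le> b' \<and> b' \<le> length P \<and> Q (subpath P a' b') \<longrightarrow> a' = a \<and> b' = b)"

definition ascent :: "step list \<Rightarrow> nat \<Rightarrow> nat \<Rightarrow> bool" where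
  "ascent = maximal_subpath (\<lambda>w. \<exists>k\<ge>1. w = replicate k U)"

definition pyramid :: "step list \<Rightarrow> nat \<Rightarrow> nat \<Rightarrow> bool" where
  "pyramid = maximal_subpath (\<lambda>w. \<exists>k\<ge>1. w = replicate k U @ replicate k D)"

definition pyramid_ascent :: "step list \<Rightarrow> nat \<Rightarrow> nat \<Rightarrow> bool" where
  "pyramid_ascent P a b \<longleftrightarrow> ascent P a b \<and> pyramid P a (b + (b - a))"

definition npa :: "nat \<Rightarrow> nat \<Rightarrow> step list \<Rightarrow> nat" where
  "npa j m P = card {(a, b). pyramid_ascent P a b \<and> int j dvd height m P b}"

text \<open>
  The generating functions are given by their coefficients of \<open>x ^ n\<close>; these are sums over
  finite sets, by \<open>finite_jmd_paths_size\<close> below.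
\<close>

definition size_gf :: "nat \<Rightarrow> nat \<Rightarrow> nat \<Rightarrow> rat fps" where
  "size_gf j m d = Abs_fps (\<lambda>n. \<Sum>P\<in>{P \<in> jmd_paths j m d. path_size j P = n}. 1)"

definition size_npa_gf :: "nat \<Rightarrow> nat \<Rightarrow> nat \<Rightarrow> rat fps fps" where
  "size_npa_gf j m d =
     Abs_fps (\<lambda>n. \<Sum>P\<in>{P \<in> jmd_paths j m d. path_size j P = n}. fps_X ^ npa j m P)"

lemma sum_step_height:
  "(\<Sum>s\<leftarrow>P. step_height s) = int (length P) - 2 * int (count_list P D)"
proof (induction P)
  case (Cons s P)
  thus ?case by (cases s) auto
qed simp

lemma finite_jmd_paths_size:
  assumes "j > 0"
  shows "finite {P \<in> jmd_paths j m d. path_size j P = n}"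
proof (rule finite_subset)
  show "{P \<in> jmd_paths j m d. path_size j P = n} \<subseteq>
          {P. set P \<subseteq> {U, D} \<and> length P \<le> 2 * (j * Suc n)}"
  proof
    fix P assume P: "P \<in> {P \<in> jmd_paths j m d. path_size j P = n}"
    have "count_list P D < j * Suc n"
      using dividend_less_times_div[OF assms, of "count_list P D"] P
      by (simp add: path_size_def)
    moreover have "length P \<le> 2 * count_list P D"
    proof -
      have "int (length P) \<le> 2 * int (count_list P D)"
        using P by (simp add: jmd_paths_def height_def sum_step_height)
      thus ?thesis
        by linarith
    qed
    ultimately have "length P \<le> 2 * (j * Suc n)"
      by (meson less_imp_le_nat mult_le_mono2 order_trans)
    moreover have "set P \<subseteq> {U, D}"
      using step.exhaust by blast
    ultimately show "P \<in> {P. set P \<subseteq> {U, D} \<and> length P \<le> 2 * (j * Suc n)}"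
      by simp
  qed
  show "finite {P. set P \<subseteq> {U, D} \<and> length P \<le> 2 * (j * Suc n)}"
    by (rule finite_lists_length_le) simp
qed

end

theory Submission
  imports Defs
begin

text \<open>
  Let \<open>G z K h\<close> be the sum of \<open>z ^ npa\<close> over the paths with \<open>K\<close> \<open>j\<close>-upsteps that lead from height
  \<open>h\<close> to the axis and stay at heights \<open>\<ge> c\<close>. Splitting a path after the first downstep, preceded by
  \<open>i\<close> \<open>j\<close>-upsteps, leaves a path counted by \<open>G z (K - i) (h + j * i - 1)\<close>. The first ascent is a
  \<open>j\<close>-nice pyramid ascent iff \<open>i \<ge> 1\<close>, \<open>j\<close> divides \<open>h\<close>, and the remaining path starts with \<open>j * i - 1\<close>
  downsteps, after which it is again at height \<open>h\<close>. For \<open>h \<ge> c\<close> and \<open>h + j * K \<noteq> 0\<close> this gives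

    \<open>G z K h = (\<Sum>i\<le>K. G z (K - i) (h + j * i - 1)) + [j dvd h] * (z - 1) * (\<Sum>i=1..K. G z (K - i) h)\<close>.

  With \<open>t = (1 - x) / (1 - x * y)\<close>, the identity \<open>t ^ (e + 1) = t ^ e + (y - 1) * x / (1 - x) * t ^ (e + 1)\<close>
  shows that the recurrence at \<open>z = y\<close> is also satisfied by the run transform of the solution at \<open>z = 1\<close>:
  the extra sum appears exactly when \<open>j\<close> divides \<open>h\<close>, where \<open>h div j\<close> exceeds \<open>(h - 1) div j\<close>.
  Paths whose lowest point is at level \<open>- d\<close> are obtained as the difference of \<open>c = - d\<close> and \<open>c = 1 - d\<close>.
\<close>

subsection \<open>Pyramid ascents\<close>

lemma subpath_eq_replicate_iff:
  assumes "a \<le> b" "b \<le> length P"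
  shows "(\<exists>k\<ge>1. subpath P a b = replicate k s) \<longleftrightarrow> a < b \<and> (\<forall>i\<in>{a..<b}. P ! i = s)"
proof -
  have len: "length (subpath P a b) = b - a"
    using assms by (simp add: subpath_def)
  have nth: "subpath P a b ! i = P ! (a + i)" if "i < b - a" for i
    using that assms by (simp add: subpath_def)
  have "(\<exists>k\<ge>1. subpath P a b = replicate k s) \<longleftrightarrow> 1 \<le> b - a \<and> subpath P a b = replicate (b - a) s"
    using len by (metis length_replicate)
  also have "\<dots> \<longleftrightarrow> a < b \<and> (\<forall>i<b - a. P ! (a + i) = s)"
    using assms len nth by (auto simp: list_eq_iff_nth_eq)
  also have "(\<forall>i<b - a. P ! (a + i) = s) \<longleftrightarrow> (\<forall>i\<in>{a..<b}. P ! i = s)"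
  proof safe
    fix i assume "\<forall>i<b - a. P ! (a + i) = s" "i \<in> {a..<b}"
    thus "P ! i = s" by (auto dest!: spec[of _ "i - a"])
  next
    fix i assume "\<forall>i\<in>{a..<b}. P ! i = s" "i < b - a"
    thus "P ! (a + i) = s" by simp
  qed
  finally show ?thesis .
qed

lemma subpath_eq_pyramid_iff:
  assumes "a \<le> b" "b \<le> length P"
  shows "(\<exists>k\<ge>1. subpath P a b = replicate k U @ replicate k D) \<longleftrightarrow>
    (\<exists>k\<ge>1. b = a + 2 * k \<and> (\<forall>i\<in>{a..<a+k}. P ! i = U) \<and> (\<forall>i\<in>{a+k..<b}. P ! i = D))"
    (is "?l \<longleftrightarrow> ?r")
proof -
  have len: "length (subpath P a b) = b - a"
    using assms by (simp add: subpath_def)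
  have nth: "subpath P a b ! i = P ! (a + i)" if "i < b - a" for i
    using that assms by (simp add: subpath_def)
  show ?thesis
  proof
    assume ?l
    then obtain k where k: "k \<ge> 1" "subpath P a b = replicate k U @ replicate k D" by blast
    have b: "b = a + 2 * k" using len k assms by simp
    have "P ! i = (if i < a + k then U else D)" if "i \<in> {a..<b}" for i
    proof -
      have "P ! i = subpath P a b ! (i - a)" using nth[of "i - a"] that by (simp add: diff_less_mono)
      also have "\<dots> = (if i < a + k then U else D)" unfolding k(2) using that b by (auto simp: nth_append)
      finally show ?thesis .
    qed
    thus ?r using k(1) b by (intro exI[of _ k]) auto
  next
    assume ?r
    then obtain k where k: "k \<ge> 1" "b = a + 2 * k"
      "\<forall>i\<in>{a..<a+k}. P ! i = U" "\<forall>i\<in>{a+k..<b}. P ! i = D" by blast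
    have "subpath P a b = replicate k U @ replicate k D"
    proof (rule nth_equalityI)
      fix i assume "i < length (subpath P a b)"
      hence i: "i < 2 * k" "i < b - a" unfolding len using k(2) by simp_all
      have "P ! (a + i) = (if i < k then U else D)"
        using k(2-4) i by simp
      thus "subpath P a b ! i = (replicate k U @ replicate k D) ! i"
        using i by (simp add: nth nth_append)
    qed (simp only: len, simp add: k(2))
    thus ?l using k(1) by blast
  qed
qed

text \<open>Any longer run of \<open>U\<close> contains a letter adjacent to the given run, so the
  two neighbouring letters decide maximality.\<close>

lemma ascent_iff:
  "ascent P a b \<longleftrightarrow> a < b \<and> b \<le> length P \<and> (\<forall>i\<in>{a..<b}. P ! i = U) \<and>
     (a = 0 \<or> P ! (a - 1) = D) \<and> (b = length P \<or> P ! b = D)"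
  (is "?l \<longleftrightarrow> ?r")
proof
  assume l: ?l
  hence ab: "a \<le> b" "b \<le> length P" by (auto simp: ascent_def maximal_subpath_def)
  have u: "a < b" "\<forall>i\<in>{a..<b}. P ! i = U"
    using l subpath_eq_replicate_iff[OF ab, of U] by (auto simp: ascent_def maximal_subpath_def)
  have mx: "a' = a \<and> b' = b"
    if "a' \<le> a" "b \<le> b'" "b' \<le> length P" "\<forall>i\<in>{a'..<b'}. P ! i = U" for a' b'
  proof -
    have "\<exists>k\<ge>1. subpath P a' b' = replicate k U"
      using that u(1) by (subst subpath_eq_replicate_iff) auto
    thus ?thesis using l that unfolding ascent_def maximal_subpath_def by blast
  qed
  have "P ! (a - 1) = D" if "a \<noteq> 0"
  proof (rule ccontr)
    assume "P ! (a - 1) \<noteq> D"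
    hence "P ! (a - 1) = U" by (cases "P ! (a - 1)") auto
    moreover have "i = a - 1 \<or> i \<in> {a..<b}" if "i \<in> {a - 1..<b}" for i
      using that by auto
    ultimately have "\<forall>i\<in>{a - 1..<b}. P ! i = U" using u by blast
    from mx[OF _ _ _ this] that ab show False by auto
  qed
  moreover have "P ! b = D" if "b \<noteq> length P"
  proof (rule ccontr)
    assume "P ! b \<noteq> D"
    hence "P ! b = U" by (cases "P ! b") auto
    hence "\<forall>i\<in>{a..<Suc b}. P ! i = U" using u by (auto simp: less_Suc_eq)
    from mx[OF _ _ _ this] that ab show False by auto
  qed
  ultimately show ?r using u ab by auto
next
  assume r: ?r
  have "a' = a \<and> b' = b"
    if "a' \<le> a" "b \<le> b'" "b' \<le> length P" "\<exists>k\<ge>1. subpath P a' b' = replicate k U" for a' b'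
  proof -
    have u: "\<forall>i\<in>{a'..<b'}. P ! i = U"
      using that r subpath_eq_replicate_iff[of a' b' P U] by auto
    have "a' = a"
    proof (rule ccontr)
      assume "a' \<noteq> a"
      hence "P ! (a - 1) = U" using that(1,2) r by (intro bspec[OF u]) auto
      thus False using r \<open>a' \<noteq> a\<close> that by auto
    qed
    moreover have "b' = b"
    proof (rule ccontr)
      assume "b' \<noteq> b"
      hence "P ! b = U" using that(1,2) r by (intro bspec[OF u]) auto
      thus False using r \<open>b' \<noteq> b\<close> that by auto
    qed
    ultimately show ?thesis ..
  qed
  moreover have "\<exists>k\<ge>1. subpath P a b = replicate k U"
    using r by (subst subpath_eq_replicate_iff) auto
  ultimately show ?l using r by (auto simp: ascent_def maximal_subpath_def)
qed

text \<open>A pyramid containing the one at \<open>a\<close> has its peak at \<open>b\<close> too,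
  so it would extend the ascent to the left. The letter before \<open>a\<close> thus settles the
  maximality of the pyramid as well as the left end of the ascent; the \<open>D\<close> at
  \<open>b\<close> settles the right end.\<close>

lemma pyramid_ascent_iff:
  "pyramid_ascent P a b \<longleftrightarrow> a < b \<and> 2 * b \<le> length P + a \<and> (\<forall>i\<in>{a..<b}. P ! i = U) \<and>
     (\<forall>i\<in>{b..<2 * b - a}. P ! i = D) \<and> (a = 0 \<or> P ! (a - 1) = D)"
  (is "?l \<longleftrightarrow> ?r")
proof
  assume l: ?l
  define e where "e = b + (b - a)"
  have asc: "ascent P a b" and pyr: "pyramid P a e"
    using l by (auto simp: pyramid_ascent_def e_def)
  have ae: "a \<le> e" "e \<le> length P" using pyr by (auto simp: pyramid_def maximal_subpath_def)
  have ab: "a < b" using asc by (simp add: ascent_iff)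
  obtain k where k: "k \<ge> 1" "e = a + 2 * k" "\<forall>i\<in>{a..<a+k}. P ! i = U" "\<forall>i\<in>{a+k..<e}. P ! i = D"
    using pyr subpath_eq_pyramid_iff[OF ae] unfolding pyramid_def maximal_subpath_def by blast
  have "b = a + k" using ab k(2) by (simp add: e_def)
  thus ?r using asc ab k ae by (auto simp: ascent_iff)
next
  assume r: ?r
  define e where "e = b + (b - a)"
  have ae: "a \<le> e" "e \<le> length P" using r by (auto simp: e_def)
  have asc: "ascent P a b" using r by (auto simp: ascent_iff)
  have "\<exists>k\<ge>1. e = a + 2 * k \<and> (\<forall>i\<in>{a..<a+k}. P ! i = U) \<and> (\<forall>i\<in>{a+k..<e}. P ! i = D)"
    using r by (intro exI[of _ "b - a"]) (auto simp: e_def)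
  hence q: "\<exists>k\<ge>1. subpath P a e = replicate k U @ replicate k D"
    using subpath_eq_pyramid_iff[OF ae] by blast
  have "a' = a \<and> e' = e"
    if h: "a' \<le> a" "e \<le> e'" "e' \<le> length P"
      "\<exists>k\<ge>1. subpath P a' e' = replicate k U @ replicate k D" for a' e'
  proof -
    have "a' \<le> e'" using h ae by simp
    then obtain k where k: "k \<ge> 1" "e' = a' + 2 * k" "\<forall>i\<in>{a'..<a'+k}. P ! i = U"
      "\<forall>i\<in>{a'+k..<e'}. P ! i = D"
      using h(3,4) subpath_eq_pyramid_iff[of a' e' P] by blast
    \<comment> \<open>A later peak would put the \<open>D\<close> at \<open>b\<close> into the
      ascent of the larger pyramid; an earlier one would put the \<open>U\<close> at
      \<open>b - 1\<close> into its descent.\<close>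
    have b: "a' + k = b"
    proof (rule antisym)
      show "a' + k \<le> b"
      proof (rule ccontr)
        assume "\<not> ?thesis"
        hence "P ! b = U" using h(1) r by (intro bspec[OF k(3)]) auto
        moreover have "P ! b = D" using r by auto
        ultimately show False by simp
      qed
      show "b \<le> a' + k"
      proof (rule ccontr)
        assume *: "\<not> ?thesis"
        hence "P ! (b - 1) = D" using k(2) h(2) r by (intro bspec[OF k(4)]) (auto simp: e_def)
        moreover have "P ! (b - 1) = U" using r by auto
        ultimately show False by simp
      qed
    qed
    have "a' = a"
    proof (rule ccontr)
      assume ne: "a' \<noteq> a"
      hence "P ! (a - 1) = U" using h(1) b r by (intro bspec[OF k(3)]) auto
      thus False using r ne h(1) by auto
    qed
    thus ?thesis using b k(2) by (auto simp: e_def)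
  qed
  hence "pyramid P a e" using ae q unfolding pyramid_def maximal_subpath_def by blast
  thus ?l using asc by (simp add: pyramid_ascent_def e_def)
qed

text \<open>No ascent starts at a position from \<open>1\<close> to \<open>k\<close>, since a
  \<open>U\<close> precedes it. The displayed \<open>D\<close> is the first of the \<open>k\<close>
  downsteps of a pyramid on the first ascent, so \<open>R\<close> has to supply \<open>k - 1\<close>
  more.\<close>

lemma pyramid_ascent_first_ascent:
  "pyramid_ascent (replicate k U @ D # R) a b \<longleftrightarrow>
     a = 0 \<and> b = k \<and> k \<ge> 1 \<and> take (k - 1) R = replicate (k - 1) D \<or>
     a \<ge> Suc k \<and> b \<ge> Suc k \<and> pyramid_ascent R (a - Suc k) (b - Suc k)"
  (is "pyramid_ascent ?P a b \<longleftrightarrow> ?A \<or> ?B")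
proof -
  have nU: "?P ! i = U" if "i < k" for i using that by (simp add: nth_append)
  have nD: "?P ! k = D" by (simp add: nth_append)
  have nR: "?P ! (Suc k + i) = R ! i" for i by (simp add: nth_append)
  have nR': "?P ! i = R ! (i - Suc k)" if "i > k" for i using that by (simp add: nth_append)
  consider "a = 0" | "0 < a" "a \<le> k" | "a \<ge> Suc k" by linarith
  thus ?thesis
  proof cases
    case 1
    have tk: "take (k - 1) R = replicate (k - 1) D \<longleftrightarrow>
        k - 1 \<le> length R \<and> (\<forall>i<k - 1. R ! i = D)"
      by (auto simp: list_eq_iff_nth_eq)
    have at0: "pyramid_ascent Q 0 b \<longleftrightarrow> b > 0 \<and> 2 * b \<le> length Q \<and> (\<forall>i<b. Q ! i = U) \<and>
        (\<forall>i. b \<le> i \<and> i < 2 * b \<longrightarrow> Q ! i = D)" for Q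
      by (auto simp: pyramid_ascent_iff)
    have "pyramid_ascent ?P 0 b \<longleftrightarrow> b = k \<and> k \<ge> 1 \<and> k - 1 \<le> length R \<and> (\<forall>i<k - 1. R ! i = D)"
    proof
      assume p: "pyramid_ascent ?P 0 b"
      hence b0: "b > 0" and bU: "\<And>i. i < b \<Longrightarrow> ?P ! i = U"
        and bD: "\<And>i. b \<le> i \<Longrightarrow> i < 2 * b \<Longrightarrow> ?P ! i = D" and l: "2 * b \<le> length ?P"
        unfolding at0 by blast+
      have "b \<le> k" using bU[of k] nD by (cases "k < b") auto
      moreover have "k \<le> b" using bD[of b] nU[of b] b0 by (cases "b < k") auto
      ultimately have bk: "b = k" by simp
      have "R ! i = D" if "i < k - 1" for i
        using bD[of "Suc k + i"] that unfolding nR bk by simp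
      thus "b = k \<and> k \<ge> 1 \<and> k - 1 \<le> length R \<and> (\<forall>i<k - 1. R ! i = D)"
        using bk b0 l by auto
    next
      assume *: "b = k \<and> k \<ge> 1 \<and> k - 1 \<le> length R \<and> (\<forall>i<k - 1. R ! i = D)"
      have "?P ! i = D" if "k \<le> i" "i < 2 * k" for i
        using that * nD nR'[of i] by (cases "i = k") auto
      moreover have "b > 0" "2 * b \<le> length ?P" using * by auto
      ultimately show "pyramid_ascent ?P 0 b" unfolding at0 using * nU by blast
    qed
    thus ?thesis using 1 tk by simp
  next
    case 2
    have "?P ! (a - 1) = U" using 2 nU by simp
    thus ?thesis using 2 by (auto simp: pyramid_ascent_iff)
  next
    case 3
    define a' where "a' = a - Suc k"
    have a: "a = Suc k + a'" using 3 by (simp add: a'_def)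
    have "pyramid_ascent ?P a b \<longleftrightarrow> b \<ge> Suc k \<and> pyramid_ascent R a' (b - Suc k)"
    proof (cases "b \<ge> Suc k")
      case True
      define b' where "b' = b - Suc k"
      have b: "b = Suc k + b'" using True by (simp add: b'_def)
      have sh: "(\<forall>i\<in>{Suc k + l..<Suc k + r}. ?P ! i = s) \<longleftrightarrow> (\<forall>i\<in>{l..<r}. R ! i = s)" for l r s
      proof safe
        fix i assume "\<forall>i\<in>{Suc k + l..<Suc k + r}. ?P ! i = s" "i \<in> {l..<r}"
        thus "R ! i = s" using nR[of i] by (auto dest!: bspec[of _ _ "Suc k + i"])
      next
        fix i assume "\<forall>i\<in>{l..<r}. R ! i = s" "i \<in> {Suc k + l..<Suc k + r}"
        thus "?P ! i = s" using nR'[of i] by (auto dest!: bspec[of _ _ "i - Suc k"])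
      qed
      \<comment> \<open>The \<open>D\<close> at position \<open>k\<close> precedes \<open>R\<close>,
        so an ascent at the very start of \<open>R\<close> remains one in the whole word.\<close>
      have pre: "(Suc k + a' = 0 \<or> ?P ! (Suc k + a' - 1) = D) \<longleftrightarrow> (a' = 0 \<or> R ! (a' - 1) = D)"
        using nD nR[of "a' - 1"] by (cases a') auto
      have e: "2 * (Suc k + b') - (Suc k + a') = Suc k + (2 * b' - a')" if "a' < b'"
        using that by simp
      have "pyramid_ascent ?P (Suc k + a') (Suc k + b') \<longleftrightarrow> pyramid_ascent R a' b'"
      proof (cases "a' < b'")
        case True
        show ?thesis unfolding pyramid_ascent_iff e[OF True] sh pre by auto
      qed (simp add: pyramid_ascent_iff)
      thus ?thesis using True by (simp add: a b'_def)
    next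
      case False
      thus ?thesis using 3 by (auto simp: pyramid_ascent_iff)
    qed
    thus ?thesis using 3 by (simp add: a'_def)
  qed
qed

lemma finite_pyramid_ascents: "finite {(a, b). pyramid_ascent P a b}"
  by (rule finite_subset[of _ "{..length P} \<times> {..length P}"]) (auto simp: pyramid_ascent_iff)

text \<open>\<open>npa\<close> with an integer initial height, since suffixes of a path may start below the axis.\<close>

definition npa_from :: "nat \<Rightarrow> int \<Rightarrow> step list \<Rightarrow> nat" where
  "npa_from j h P =
     card {(a, b). pyramid_ascent P a b \<and> int j dvd h + (\<Sum>s\<leftarrow>take b P. step_height s)}"

lemma npa_eq_npa_from: "npa j m P = npa_from j (int m) P"
  by (simp add: npa_def npa_from_def height_def)

lemma npa_from_replicate_U [simp]: "npa_from j h (replicate k U) = 0"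
proof -
  have "\<not> pyramid_ascent (replicate k U) a b" for a b
  proof
    assume *: "pyramid_ascent (replicate k U) a b"
    hence "a < b" "2 * b \<le> k + a" "\<forall>i\<in>{b..<2 * b - a}. replicate k U ! i = D"
      by (simp_all add: pyramid_ascent_iff)
    hence "b \<in> {b..<2 * b - a} \<and> b < k" "\<forall>i\<in>{b..<2 * b - a}. replicate k U ! i = D"
      by auto
    hence "replicate k U ! b = D" "b < k" by blast+
    thus False by simp
  qed
  thus ?thesis by (simp add: npa_from_def)
qed

text \<open>The pyramid ascents beyond the first downstep are those of \<open>R\<close>, shifted by
  \<open>Suc k\<close>, with unchanged heights because \<open>R\<close> starts at
  \<open>h + k - 1\<close>. Only the first ascent, which ends at height \<open>h + k\<close>, can
  add one more.\<close>

lemma npa_from_first_ascent: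
  "npa_from j h (replicate k U @ D # R) =
     (if k \<ge> 1 \<and> int j dvd h + int k \<and> take (k - 1) R = replicate (k - 1) D then 1 else 0) +
     npa_from j (h + int k - 1) R"
proof -
  let ?P = "replicate k U @ D # R" and ?sh = "\<lambda>(a, b). (Suc k + a, Suc k + b)"
  let ?f = "\<lambda>h P. {(a, b). pyramid_ascent P a b \<and> int j dvd h + (\<Sum>s\<leftarrow>take b P. step_height s)}"
  let ?c = "k \<ge> 1 \<and> int j dvd h + int k \<and> take (k - 1) R = replicate (k - 1) D"
  have ht: "h + (\<Sum>s\<leftarrow>take (Suc k + b) ?P. step_height s) =
      h + int k - 1 + (\<Sum>s\<leftarrow>take b R. step_height s)" for b
    by (simp add: sum_list_replicate)
  have ht': "h + (\<Sum>s\<leftarrow>take b ?P. step_height s) =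
      h + int k - 1 + (\<Sum>s\<leftarrow>take (b - Suc k) R. step_height s)" if "b \<ge> Suc k" for b
    using ht[of "b - Suc k"] that by (simp only: le_add_diff_inverse)
  have htk: "h + (\<Sum>s\<leftarrow>take k ?P. step_height s) = h + int k"
    by (simp add: sum_list_replicate)
  have "?f h ?P = (if ?c then {(0, k)} else {}) \<union> ?sh ` ?f (h + int k - 1) R"
  proof (rule set_eqI, clarify)
    fix a b
    have "(a, b) \<in> ?sh ` ?f (h + int k - 1) R \<longleftrightarrow>
        a \<ge> Suc k \<and> b \<ge> Suc k \<and> (a - Suc k, b - Suc k) \<in> ?f (h + int k - 1) R"
    proof
      assume *: "a \<ge> Suc k \<and> b \<ge> Suc k \<and> (a - Suc k, b - Suc k) \<in> ?f (h + int k - 1) R"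
      thus "(a, b) \<in> ?sh ` ?f (h + int k - 1) R"
        by (intro image_eqI[where x = "(a - Suc k, b - Suc k)"]) auto
    qed auto
    also have "\<dots> \<longleftrightarrow> a \<ge> Suc k \<and> b \<ge> Suc k \<and> pyramid_ascent R (a - Suc k) (b - Suc k) \<and>
        int j dvd h + (\<Sum>s\<leftarrow>take b ?P. step_height s)"
      by (cases "b \<ge> Suc k") (simp_all only: mem_Collect_eq prod.case ht' simp_thms)
    finally show "(a, b) \<in> ?f h ?P \<longleftrightarrow>
        (a, b) \<in> (if ?c then {(0, k)} else {}) \<union> ?sh ` ?f (h + int k - 1) R"
      using htk pyramid_ascent_first_ascent[of k R a b] by auto
  qed
  moreover have "finite (?f (h + int k - 1) R)"
    by (rule finite_subset[OF _ finite_pyramid_ascents[of R]]) auto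
  moreover have "(if ?c then {(0, k)} else {}) \<inter> ?sh ` ?f (h + int k - 1) R = {}"
    by auto
  moreover have "inj_on ?sh A" for A by (auto simp: inj_on_def)
  ultimately show ?thesis
    by (simp add: npa_from_def card_Un_disjoint card_image)
qed

text \<open>This is the case \<open>k = 0\<close> of \<open>npa_from_first_ascent\<close>, iterated.
  It serves to strip the descent of a pyramid from the remaining path.\<close>

lemma npa_from_replicate_D: "npa_from j h (replicate r D @ R) = npa_from j (h - int r) R"
proof (induction r arbitrary: h)
  case (Suc r)
  show ?case
    using npa_from_first_ascent[of j h 0 "replicate r D @ R"] Suc.IH[of "h - 1"]
    by (simp add: algebra_simps)
qed simp


subsection \<open>The recurrence\<close>

definition ud_words :: "nat \<Rightarrow> step list set" where
  "ud_words j = {P. \<exists>ss. set ss \<subseteq> {replicate j U, [D]} \<and> P = concat ss}"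

lemma ud_words_Nil [simp]: "[] \<in> ud_words j"
  by (auto simp: ud_words_def intro: exI[of _ "[]"])

lemma ud_words_append:
  assumes "P \<in> ud_words j" "Q \<in> ud_words j"
  shows "P @ Q \<in> ud_words j"
proof -
  obtain ss tt where "set ss \<subseteq> {replicate j U, [D]}" "P = concat ss"
    "set tt \<subseteq> {replicate j U, [D]}" "Q = concat tt"
    using assms by (auto simp: ud_words_def)
  thus ?thesis unfolding ud_words_def by (intro CollectI exI[of _ "ss @ tt"]) auto
qed

lemma ud_words_upstep: "replicate j U \<in> ud_words j"
  unfolding ud_words_def by (intro CollectI exI[of _ "[replicate j U]"]) auto

lemma ud_words_D: "[D] \<in> ud_words j"
  unfolding ud_words_def by (intro CollectI exI[of _ "[[D]]"]) auto

lemma ud_words_replicate_U: "replicate (j * i) U \<in> ud_words j"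
  by (induction i) (simp_all add: replicate_add ud_words_append ud_words_upstep)

lemma ud_words_replicate_D: "replicate r D \<in> ud_words j"
proof (induction r)
  case (Suc r)
  thus ?case using ud_words_append[OF ud_words_D Suc] by simp
qed simp

text \<open>All blocks before the first \<open>[D]\<close> are upsteps, which makes the length of
  the initial run a multiple of \<open>j\<close>.\<close>

lemma concat_first_ascent:
  assumes "set ss \<subseteq> {replicate j U, [D]}"
  shows "\<exists>i. concat ss = replicate (j * i) U \<or>
    (\<exists>tt. set tt \<subseteq> {replicate j U, [D]} \<and> concat ss = replicate (j * i) U @ D # concat tt)"
  using assms
proof (induction ss)
  case Nil
  show ?case by (rule exI[of _ 0]) simp
next
  case (Cons s ss)
  consider "s = replicate j U" | "s = [D]" using Cons.prems by auto
  thus ?case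
  proof cases
    case 1
    obtain i where "concat ss = replicate (j * i) U \<or>
      (\<exists>tt. set tt \<subseteq> {replicate j U, [D]} \<and> concat ss = replicate (j * i) U @ D # concat tt)"
      using Cons by auto
    thus ?thesis using 1 by (intro exI[of _ "Suc i"]) (auto simp: replicate_add)
  next
    case 2
    show ?thesis using 2 Cons.prems by (intro exI[of _ 0] disjI2 exI[of _ ss]) auto
  qed
qed

lemma ud_words_cases:
  assumes "P \<in> ud_words j"
  obtains i where "P = replicate (j * i) U"
  | i R where "R \<in> ud_words j" "P = replicate (j * i) U @ D # R"
  using assms concat_first_ascent[of _ j] unfolding ud_words_def by blast

lemma dvd_count_ud_words:
  assumes "P \<in> ud_words j"
  shows "j dvd count_list P U"
proof -
  have count: "count_list (replicate n U) U = n" for n by (induction n) auto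
  obtain ss where "set ss \<subseteq> {replicate j U, [D]}" "P = concat ss"
    using assms by (auto simp: ud_words_def)
  thus ?thesis
    by (induction ss arbitrary: P) (auto simp: count)
qed

section \<open>Paths bounded below and their first ascents\<close>

fun stays_above :: "int \<Rightarrow> int \<Rightarrow> step list \<Rightarrow> bool" where
  "stays_above c h [] \<longleftrightarrow> c \<le> h"
| "stays_above c h (s # P) \<longleftrightarrow> c \<le> h \<and> stays_above c (h + step_height s) P"

text \<open>The recursive form allows prefixes to be stripped off; this equivalence ties it to the
  minimum over all positions in \<open>jmd_paths\<close>.\<close>

lemma stays_above_iff:
  "stays_above c h P \<longleftrightarrow> (\<forall>i\<le>length P. c \<le> h + (\<Sum>s\<leftarrow>take i P. step_height s))"
proof (induction P arbitrary: h)
  case (Cons s P)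
  have "(\<forall>i\<le>length (s # P). c \<le> h + (\<Sum>s\<leftarrow>take i (s # P). step_height s)) \<longleftrightarrow>
      c \<le> h \<and> (\<forall>i\<le>length P. c \<le> h + (\<Sum>s\<leftarrow>take (Suc i) (s # P). step_height s))"
    using All_less_Suc2[of "Suc (length P)" "\<lambda>i. c \<le> h + (\<Sum>s\<leftarrow>take i (s # P). step_height s)"]
    by (simp only: less_Suc_eq_le list.size) simp
  thus ?case by (simp add: Cons.IH algebra_simps)
qed simp

lemma stays_above_start: "stays_above c h P \<Longrightarrow> c \<le> h"
  by (cases P) auto

text \<open>An ascent is lowest at its start and a descent at its end; this lemma and the next
  reduce the bound along a run to that point.\<close>

lemma stays_above_replicate_U:
  "stays_above c h (replicate n U @ P) \<longleftrightarrow> c \<le> h \<and> stays_above c (h + int n) P"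
proof (induction n arbitrary: h)
  case 0
  show ?case using stays_above_start[of c h P] by auto
next
  case (Suc n)
  show ?case using Suc.IH[of "h + 1"] by (auto simp: add.assoc)
qed

lemma stays_above_replicate_D:
  "stays_above c h (replicate n D @ P) \<longleftrightarrow> stays_above c (h - int n) P"
proof (induction n arbitrary: h)
  case (Suc n)
  have "h - int (Suc n) = h - 1 - int n" by simp
  show ?case unfolding \<open>h - int (Suc n) = h - 1 - int n\<close>
     using Suc.IH[of "h - 1"] stays_above_start[of c "h - 1 - int n" P] by auto
qed simp

text \<open>Fixing \<open>K\<close> and \<open>h\<close> fixes the number of downsteps to
  \<open>h + j * K\<close>, and with it the size. The height \<open>h\<close> is an integer because
  remainders of paths may start below the axis.\<close>

definition paths_above :: "nat \<Rightarrow> int \<Rightarrow> nat \<Rightarrow> int \<Rightarrow> step list set" where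
  "paths_above j c K h = {P \<in> ud_words j. count_list P U = j * K \<and> stays_above c h P \<and>
     h + (\<Sum>s\<leftarrow>P. step_height s) = 0}"

lemma count_list_replicate: "count_list (replicate n x) y = (if x = y then n else 0)"
  by (induction n) auto

lemma length_eq_count: "length P = count_list P U + count_list P D"
proof (induction P)
  case (Cons s P)
  thus ?case by (cases s) auto
qed simp

lemma count_D_eq:
  assumes "count_list P U = j * K" "h + (\<Sum>s\<leftarrow>P. step_height s) = 0"
  shows "int (count_list P D) = h + int j * int K"
  using assms by (simp add: sum_step_height length_eq_count)

lemma finite_paths_above: "finite (paths_above j c K h)"
proof (rule finite_subset)
  show "paths_above j c K h \<subseteq> {P. set P \<subseteq> {U, D} \<and> length P \<le> nat (h + 2 * int j * int K)}"
  proof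
    fix P assume P: "P \<in> paths_above j c K h"
    have set: "set P \<subseteq> {U, D}" using step.exhaust by blast
    have "int (length P) = h + 2 * int j * int K"
      using P count_D_eq[of P j K h] length_eq_count[of P] by (auto simp: paths_above_def)
    thus "P \<in> {P. set P \<subseteq> {U, D} \<and> length P \<le> nat (h + 2 * int j * int K)}"
      using set by simp
  qed
  show "finite {P. set P \<subseteq> {U, D} \<and> length P \<le> nat (h + 2 * int j * int K)}"
    by (rule finite_lists_length_le) simp
qed

lemma paths_above_empty: "h < c \<Longrightarrow> paths_above j c K h = {}"
  by (auto simp: paths_above_def dest: stays_above_start)

text \<open>A word without downsteps ends at \<open>h + j * K\<close>; this must be the axis, whence
  the bound requires \<open>c \<le> 0\<close>. In any other word the bound on the ascent before the
  first downstep follows from \<open>c \<le> h\<close>.\<close>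

lemma paths_above_first_ascent:
  assumes "j > 0" "c \<le> h"
  shows "paths_above j c K h =
    (if c \<le> 0 \<and> h + int j * int K = 0 then {replicate (j * K) U} else {}) \<union>
    (\<Union>i\<le>K. (\<lambda>R. replicate (j * i) U @ D # R) ` paths_above j c (K - i) (h + int (j * i) - 1))"
    (is "_ = ?A \<union> ?B")
proof (intro equalityI subsetI)
  fix P assume P: "P \<in> paths_above j c K h"
  hence "P \<in> ud_words j" by (simp add: paths_above_def)
  thus "P \<in> ?A \<union> ?B"
  proof (cases rule: ud_words_cases)
    case (1 i)
    have "i = K" using P assms by (simp add: 1 paths_above_def count_list_replicate)
    thus ?thesis
      using P stays_above_replicate_U[of c h "j * i" "[]"]
      by (simp add: 1 paths_above_def sum_list_replicate)
  next
    case (2 i R)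
    have ct: "j * K = j * i + count_list R U"
      using P by (simp add: 2 paths_above_def count_list_replicate)
    hence "j * i \<le> j * K" by simp
    hence iK: "i \<le> K" using assms by simp
    have "count_list R U = j * (K - i)" using ct by (simp add: diff_mult_distrib2)
    hence "R \<in> paths_above j c (K - i) (h + int (j * i) - 1)"
      using P 2(1) by (simp add: 2 paths_above_def stays_above_replicate_U sum_list_replicate)
    thus ?thesis using iK 2 by blast
  qed
next
  fix P assume "P \<in> ?A \<union> ?B"
  thus "P \<in> paths_above j c K h"
  proof
    assume "P \<in> ?A"
    thus ?thesis
      using assms stays_above_replicate_U[of c h "j * K" "[]"] ud_words_replicate_U[of j K]
      by (auto simp: paths_above_def count_list_replicate sum_list_replicate split: if_splits)
  next
    assume "P \<in> ?B"
    then obtain i R where i: "i \<le> K" and R: "R \<in> paths_above j c (K - i) (h + int (j * i) - 1)"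
      and P: "P = replicate (j * i) U @ [D] @ R" by auto
    have "P \<in> ud_words j" unfolding P using R
      by (intro ud_words_append ud_words_replicate_U ud_words_D) (simp add: paths_above_def)
    moreover have "count_list P U = j * K"
      using R i by (simp add: P paths_above_def count_list_replicate flip: add_mult_distrib2)
    moreover have "c \<le> h + int (j * i)"
      using assms(2) by (intro add_increasing2) auto
    ultimately show ?thesis
      using R assms(2)
      by (simp add: paths_above_def P stays_above_replicate_U sum_list_replicate)
  qed
qed

lemma first_ascent_unique:
  "replicate k U @ D # R = replicate l U @ D # R' \<longleftrightarrow> k = l \<and> R = R'"
proof (induction k arbitrary: l)
  case 0
  show ?case by (cases l) auto
next
  case (Suc k)
  show ?case using Suc.IH by (cases l) auto
qed

text \<open>The forced descent leads from \<open>h + r\<close> to \<open>h\<close>, uses no upstep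
  and is lowest at its end, so removing it preserves all conditions.\<close>

lemma paths_above_prefix_D:
  assumes "c \<le> h"
  shows "{R \<in> paths_above j c K (h + int r). take r R = replicate r D} =
    (\<lambda>R. replicate r D @ R) ` paths_above j c K h"
proof (intro equalityI subsetI)
  fix P assume "P \<in> {R \<in> paths_above j c K (h + int r). take r R = replicate r D}"
  hence P: "P \<in> paths_above j c K (h + int r)" "take r P = replicate r D" by auto
  define R where "R = drop r P"
  have PR: "P = replicate r D @ R" using P(2) append_take_drop_id[of r P] by (simp add: R_def)
  have "R \<in> ud_words j" if "replicate r D @ R \<in> ud_words j" for r R
    using that
  proof (induction r)
    case (Suc r)
    have "replicate r D @ R \<in> ud_words j"
      using Suc.prems
    proof (cases rule: ud_words_cases)
      case (1 i)
      thus ?thesis by (cases "j * i") auto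
    next
      \<comment> \<open>Here \<open>R'\<close> names the number of upsteps and \<open>i\<close> the
        remaining word. The word begins with \<open>D\<close>, so its initial run of
        \<open>U\<close> is empty.\<close>
      case (2 R' i)
      thus ?thesis by (cases "j * R'") auto
    qed
    thus ?case by (rule Suc.IH)
  qed simp
  hence "R \<in> paths_above j c K h"
    using P(1) by (auto simp: paths_above_def PR count_list_replicate stays_above_replicate_D sum_list_replicate)
  thus "P \<in> (\<lambda>R. replicate r D @ R) ` paths_above j c K h" using PR by blast
next
  fix P assume "P \<in> (\<lambda>R. replicate r D @ R) ` paths_above j c K h"
  then obtain R where "R \<in> paths_above j c K h" "P = replicate r D @ R" by blast
  thus "P \<in> {R \<in> paths_above j c K (h + int r). take r R = replicate r D}"
    by (auto simp: paths_above_def count_list_replicate stays_above_replicate_D sum_list_replicate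
      intro: ud_words_append ud_words_replicate_D)
qed

text \<open>This is \<open>G z K h\<close> of the overview, over an arbitrary commutative ring:
  \<open>z = 1\<close> counts paths and \<open>z = fps_X\<close> records \<open>npa\<close> in
  powers of \<open>y\<close>, so one recurrence serves both.\<close>

definition npa_sum :: "nat \<Rightarrow> int \<Rightarrow> 'a::comm_ring_1 \<Rightarrow> nat \<Rightarrow> int \<Rightarrow> 'a" where
  "npa_sum j c z K h = (\<Sum>P\<in>paths_above j c K h. z ^ npa_from j h P)"

lemma npa_sum_eq_0: "h < c \<Longrightarrow> npa_sum j c z K h = 0"
  by (simp add: npa_sum_def paths_above_empty)

text \<open>The first ascent ends at \<open>h + j * i\<close>, which \<open>j\<close> divides iff it
  divides \<open>h\<close>. When it counts, \<open>z ^ (n + 1) = z ^ n + (z - 1) * z ^ n\<close>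
  isolates a correction over the paths that continue the pyramid, and these are back at height
  \<open>h\<close> after its descent.\<close>

lemma sum_first_ascent:
  assumes "j > 0" "c \<le> h"
  shows "(\<Sum>R\<in>paths_above j c K (h + int (j * i) - 1). z ^ npa_from j h (replicate (j * i) U @ D # R)) =
    npa_sum j c z K (h + int (j * i) - 1) +
    (if i \<ge> 1 \<and> int j dvd h then (z - 1) * npa_sum j c z K h else 0)"
proof (cases "i \<ge> 1 \<and> int j dvd h")
  case False
  have "int j dvd h + int j * int i \<longleftrightarrow> int j dvd h" by (subst dvd_add_left_iff) auto
  hence "npa_from j h (replicate (j * i) U @ D # R) = npa_from j (h + int (j * i) - 1) R" for R
    using False by (auto simp: npa_from_first_ascent)
  thus ?thesis using False by (auto simp: npa_sum_def)
next
  case True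
  \<comment> \<open>The \<open>D\<close> already split off is one of the \<open>j * i\<close>
    downsteps of the pyramid.\<close>
  define r where "r = j * i - 1"
  define h' where "h' = h + int (j * i) - 1"
  have ji: "j * i \<ge> 1" using True assms by (simp add: Suc_le_eq)
  have h': "h' = h + int r" using ji by (simp add: r_def h'_def of_nat_diff)
  let ?p = "\<lambda>R. take r R = replicate r D" and ?S = "paths_above j c K h'"
  have "npa_from j h (replicate (j * i) U @ D # R) = (if ?p R then 1 else 0) + npa_from j h' R" for R
    using True ji by (auto simp: npa_from_first_ascent r_def h'_def)
  hence "(\<Sum>R\<in>?S. z ^ npa_from j h (replicate (j * i) U @ D # R)) =
      (\<Sum>R\<in>?S. z ^ npa_from j h' R + (if ?p R then (z - 1) * z ^ npa_from j h' R else 0))"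
    by (intro sum.cong) (auto simp: algebra_simps)
  also have "\<dots> = npa_sum j c z K h' + (\<Sum>R\<in>{R\<in>?S. ?p R}. (z - 1) * z ^ npa_from j h' R)"
    by (simp add: sum.distrib npa_sum_def sum.inter_filter finite_paths_above)
  also have "(\<Sum>R\<in>{R\<in>?S. ?p R}. (z - 1) * z ^ npa_from j h' R) = (z - 1) * npa_sum j c z K h"
    unfolding h' paths_above_prefix_D[OF assms(2)]
    by (subst sum.reindex) (auto simp: inj_on_def npa_from_replicate_D npa_sum_def sum_distrib_left)
  finally show ?thesis using True by (simp add: h'_def)
qed

lemma npa_sum_rec:
  assumes "j > 0" "c \<le> h"
  shows "npa_sum j c z K h = (if c \<le> 0 \<and> h + int j * int K = 0 then 1 else 0) +
    (\<Sum>i\<le>K. npa_sum j c z (K - i) (h + int (j * i) - 1)) +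
    (if int j dvd h then (z - 1) * (\<Sum>i=1..K. npa_sum j c z (K - i) h) else 0)"
proof -
  let ?A = "if c \<le> 0 \<and> h + int j * int K = 0 then {replicate (j * K) U} else {}"
  let ?g = "\<lambda>i R. replicate (j * i) U @ D # R"
  let ?S = "\<lambda>i. paths_above j c (K - i) (h + int (j * i) - 1)"
  \<comment> \<open>Every word of the union contains a \<open>D\<close>, the single ascent does
    not.\<close>
  have disj: "?A \<inter> (\<Union>i\<le>K. ?g i ` ?S i) = {}"
    by (auto dest!: arg_cong[of "replicate (j * K) U" _ set])
  have "npa_sum j c z K h = (\<Sum>P\<in>?A. z ^ npa_from j h P) +
      (\<Sum>P\<in>(\<Union>i\<le>K. ?g i ` ?S i). z ^ npa_from j h P)"
    unfolding npa_sum_def paths_above_first_ascent[OF assms, of K]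
    by (rule sum.union_disjoint[OF _ _ disj]) (auto simp: finite_paths_above)
  also have "(\<Sum>P\<in>?A. z ^ npa_from j h P) = (if c \<le> 0 \<and> h + int j * int K = 0 then 1 else 0)"
    by simp
  \<comment> \<open>The length \<open>j * i\<close> of the first ascent determines \<open>i\<close>
    because \<open>j > 0\<close>, so the union is disjoint.\<close>
  also have "(\<Sum>P\<in>(\<Union>i\<le>K. ?g i ` ?S i). z ^ npa_from j h P) =
      (\<Sum>i\<le>K. \<Sum>P\<in>?g i ` ?S i. z ^ npa_from j h P)"
    using assms(1) by (intro sum.UNION_disjoint) (auto simp: finite_paths_above first_ascent_unique)
  also have "\<dots> = (\<Sum>i\<le>K. \<Sum>R\<in>?S i. z ^ npa_from j h (?g i R))"
    by (simp add: sum.reindex inj_on_def)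
  also have "\<dots> = (\<Sum>i\<le>K. npa_sum j c z (K - i) (h + int (j * i) - 1) +
      (if i \<ge> 1 \<and> int j dvd h then (z - 1) * npa_sum j c z (K - i) h else 0))"
    by (simp only: sum_first_ascent[OF assms])
  also have "\<dots> = (\<Sum>i\<le>K. npa_sum j c z (K - i) (h + int (j * i) - 1)) +
      (\<Sum>i\<le>K. if i \<ge> 1 \<and> int j dvd h then (z - 1) * npa_sum j c z (K - i) h else 0)"
    by (rule sum.distrib)
  also have "(\<Sum>i\<le>K. if i \<ge> 1 \<and> int j dvd h then (z - 1) * npa_sum j c z (K - i) h else 0) =
      (\<Sum>i=1..K. if int j dvd h then (z - 1) * npa_sum j c z (K - i) h else 0)"
    by (rule sum.mono_neutral_cong_right) auto
  also have "\<dots> = (if int j dvd h then (z - 1) * (\<Sum>i=1..K. npa_sum j c z (K - i) h) else 0)"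
    by (simp add: sum_distrib_left)
  finally show ?thesis by (simp only: add.assoc)
qed

subsection \<open>The run transform\<close>

text \<open>The series \<open>t\<close> of the overview; the argument of the composition in
  \<open>run_transform\<close> is \<open>x * t\<close>.\<close>

definition run_factor :: "rat fps fps" where
  "run_factor = (1 - var_x) / (1 - var_x * var_y)"

lemma run_factor_mult: "(1 - var_x * var_y) * run_factor = 1 - var_x"
  unfolding run_factor_def by (rule run_transform_denominator)

lemma run_transform_denominator_nonzero: "1 - var_x * var_y \<noteq> 0"
proof
  assume "1 - var_x * var_y = 0"
  hence "fps_nth (1 - var_x * var_y) 0 = 0" by (simp only: fps_zero_nth)
  thus False by simp
qed

text \<open>The factor \<open>x / (1 - x)\<close> in the identity for powers of \<open>t\<close> has
  coefficients 0, 1, 1, ..., which produces a sum over \<open>i \<ge> 1\<close> of the same shape as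
  the correction in \<open>npa_sum_rec\<close>.\<close>

lemma run_factor_pow_nth_rec:
  "fps_nth (run_factor ^ Suc e) n =
     fps_nth (run_factor ^ e) n + (fps_X - 1) * (\<Sum>i=1..n. fps_nth (run_factor ^ Suc e) (n - i))"
proof -
  \<comment> \<open>This is \<open>x / (1 - x)\<close>. The identity amounts to
    \<open>t * (1 - (y - 1) * s) = 1\<close>, which holds after multiplication by
    \<open>1 - x\<close> because \<open>(1 - x) - (y - 1) * x = 1 - x * y\<close>.\<close>
  define s :: "rat fps fps" where "s = Abs_fps (\<lambda>n. if n = 0 then 0 else 1)"
  have s: "(1 - var_x) * s = var_x"
    by (rule fps_ext) (auto simp: s_def left_diff_distrib)
  have nz: "1 - var_x \<noteq> (0 :: rat fps fps)"
  proof
    assume "1 - var_x = (0 :: rat fps fps)"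
    hence "fps_nth (1 - var_x :: rat fps fps) 0 = 0" by (simp only: fps_zero_nth)
    thus False by simp
  qed
  have ring: "(1 - a) * (t * (1 - (b - 1) * u)) = t * ((1 - a) - (b - 1) * ((1 - a) * u))"
    "t * ((1 - a) - (b - 1) * a) = (1 - a * b) * t" for a b t u :: "rat fps fps"
    by (simp_all add: algebra_simps)
  have "(1 - var_x) * (run_factor * (1 - (var_y - 1) * s)) = (1 - var_x) * 1"
  proof -
    have "(1 - var_x) * (run_factor * (1 - (var_y - 1) * s)) =
        run_factor * ((1 - var_x) - (var_y - 1) * ((1 - var_x) * s))"
      by (rule ring)
    also have "\<dots> = (1 - var_x * var_y) * run_factor"
      unfolding s by (rule ring)
    finally show ?thesis by (simp only: run_factor_mult mult_1_right)
  qed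
  hence "run_factor * (1 - (var_y - 1) * s) = 1"
    using nz by (simp only: mult_cancel_left) simp
  hence "run_factor ^ e * (run_factor * (1 - (var_y - 1) * s)) = run_factor ^ e"
    by (simp only: mult_1_right)
  moreover have "t * r = r * (t * (1 - b * u)) + b * (u * (t * r))" for r t b u :: "rat fps fps"
    by (simp add: algebra_simps)
  ultimately have "run_factor ^ Suc e = run_factor ^ e + (var_y - 1) * (s * run_factor ^ Suc e)"
    unfolding power_Suc by metis
  moreover have "var_y - 1 = fps_const (fps_X - 1)" by (simp flip: fps_const_sub)
  ultimately have "run_factor ^ Suc e = run_factor ^ e + fps_const (fps_X - 1) * (s * run_factor ^ Suc e)"
    by (simp only:)
  hence "fps_nth (run_factor ^ Suc e) n =
      fps_nth (run_factor ^ e) n + (fps_X - 1) * fps_nth (s * run_factor ^ Suc e) n"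
    by (metis fps_add_nth fps_mult_left_const_nth)
  also have "fps_nth (s * run_factor ^ Suc e) n = (\<Sum>i=0..n. if i = 0 then 0 else fps_nth (run_factor ^ Suc e) (n - i))"
    unfolding fps_mult_nth[of s] by (intro sum.cong) (auto simp: s_def)
  also have "\<dots> = (\<Sum>i=1..n. fps_nth (run_factor ^ Suc e) (n - i))"
    by (rule sum.mono_neutral_cong_right) auto
  finally show ?thesis .
qed

text \<open>The coefficient \<open>f_k\<close> contributes \<open>f_k * x ^ k * t ^ (k + 1)\<close>,
  one factor \<open>t\<close> coming from outside the composition.\<close>

lemma run_transform_nth:
  "fps_nth (run_transform f) n =
     (\<Sum>k\<le>n. fps_const (fps_nth f k) * fps_nth (run_factor ^ Suc k) (n - k))"
proof -
  let ?g = "var_x * (1 - var_x) / (1 - var_x * var_y)"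
  have "(1 - var_x * var_y) * ?g = (1 - var_x * var_y) * (var_x * run_factor)"
    by (simp only: run_transform_denominator run_factor_mult mult.left_commute[of _ var_x])
  hence g: "?g = var_x * run_factor"
    using run_transform_denominator_nonzero by (simp only: mult_cancel_left) simp
  have g0: "fps_nth (?g ^ k) l = 0" if "l < k" for k l
    using that by (simp only: g power_mult_distrib fps_X_power_mult_nth) simp
  have "fps_nth (run_transform f) n =
      (\<Sum>i=0..n. fps_nth run_factor i *
         (\<Sum>k=0..n - i. fps_const (fps_nth f k) * fps_nth (?g ^ k) (n - i)))"
    unfolding run_transform_def fps_compose_nth run_factor_def[symmetric] fps_mult_nth[of run_factor]
    by (simp only: fps_in_x_def fps_nth_Abs_fps)
  \<comment> \<open>The added terms with \<open>k > n - i\<close> vanish because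
    \<open>?g ^ k\<close> is divisible by \<open>x ^ k\<close>.\<close>
  also have "\<dots> = (\<Sum>i=0..n. fps_nth run_factor i *
         (\<Sum>k\<le>n. fps_const (fps_nth f k) * fps_nth (?g ^ k) (n - i)))"
    by (intro sum.cong refl arg_cong2[where f = "(*)"] sum.mono_neutral_left) (auto simp: g0)
  also have "\<dots> = (\<Sum>k\<le>n. \<Sum>i=0..n. fps_const (fps_nth f k) * (fps_nth run_factor i * fps_nth (?g ^ k) (n - i)))"
    by (simp only: sum_distrib_left mult.left_commute) (rule sum.swap)
  also have "\<dots> = (\<Sum>k\<le>n. fps_const (fps_nth f k) * fps_nth (run_factor * ?g ^ k) n)"
    by (simp only: fps_mult_nth[of run_factor] sum_distrib_left)
  also have "\<dots> = (\<Sum>k\<le>n. fps_const (fps_nth f k) * fps_nth (run_factor ^ Suc k) (n - k))"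
  proof (intro sum.cong refl arg_cong2[where f = "(*)"])
    fix k assume k: "k \<in> {..n}"
    have "run_factor * ?g ^ k = var_x ^ k * run_factor ^ Suc k"
      by (simp only: g power_mult_distrib power_Suc mult.left_commute)
    thus "fps_nth (run_factor * ?g ^ k) n = fps_nth (run_factor ^ Suc k) (n - k)"
      using k by (simp only: fps_X_power_mult_nth) simp
  qed
  finally show ?thesis .
qed

text \<open>The number of downsteps would be negative. This removes the terms where
  \<open>nat\<close> would truncate an exponent of \<open>run_factor\<close>.\<close>

lemma npa_sum_eq_0_if_neg:
  assumes "h + int j * int K < 0"
  shows "npa_sum j c z K h = 0"
proof -
  have "paths_above j c K h = {}"
  proof (rule ccontr)
    assume "paths_above j c K h \<noteq> {}"
    then obtain P where P: "P \<in> paths_above j c K h" by blast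
    thus False using assms count_D_eq[of P j K h] by (simp add: paths_above_def)
  qed
  thus ?thesis by (simp add: npa_sum_def)
qed

lemma sum_triangle:
  fixes f :: "nat \<Rightarrow> nat \<Rightarrow> 'a::comm_monoid_add"
  shows "(\<Sum>i\<le>K. \<Sum>k\<le>K - i. f i (k + i)) = (\<Sum>k\<le>K. \<Sum>i\<le>k. f i k)"
proof -
  have "(\<Sum>i\<le>K. \<Sum>k\<le>K - i. f i (k + i)) = (\<Sum>i\<le>K. \<Sum>k\<in>{i..K}. f i k)"
  proof (rule sum.cong[OF refl])
    fix i assume "i \<in> {..K}"
    thus "(\<Sum>k\<le>K - i. f i (k + i)) = (\<Sum>k\<in>{i..K}. f i k)"
      by (intro sum.reindex_bij_witness[of _ "\<lambda>k. k - i" "\<lambda>k. k + i"]) auto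
  qed
  also have "\<dots> = (\<Sum>k\<le>K. \<Sum>i\<le>k. f i k)"
    by (simp add: sum.Sigma, intro sum.reindex_bij_witness[of _ "\<lambda>(k, i). (i, k)" "\<lambda>(i, k). (k, i)"]) auto
  finally show ?thesis .
qed

text \<open>A path with \<open>k\<close> upsteps from \<open>h\<close> has \<open>h + j * k\<close>
  downsteps, so the exponent is its size \<open>k + h div j\<close> plus one, as in
  \<open>run_transform_nth\<close>. The claim covers all integer heights, since the recurrence
  changes \<open>h\<close>.\<close>

lemma npa_sum_run_factor:
  assumes "j > 0"
  shows "npa_sum j c fps_X K h =
    (\<Sum>k\<le>K. npa_sum j c 1 k h * fps_nth (run_factor ^ nat (int k + h div int j + 1)) (K - k))"
\<comment> \<open>The measure is the path length \<open>h + 2 * j * K\<close>, shifted by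
  \<open>1 - c\<close> to be positive for \<open>h \<ge> c\<close>. Splitting off a first ascent
  with its downstep, or a whole pyramid, shortens the path.\<close>
proof (induction "nat (h - c + 1 + 2 * (int j * int K))" arbitrary: K h rule: less_induct)
  case less
  define T where "T e n = fps_nth (run_factor ^ nat e) n" for e n
  define a :: "nat \<Rightarrow> rat fps" where "a k = npa_sum j c 1 k h" for k
  define b :: "nat \<Rightarrow> rat fps" where "b k = (if c \<le> 0 \<and> h + int j * int k = 0 then 1 else 0)" for k
  \<comment> \<open>The quotients \<open>q\<close> and \<open>p\<close> enter the exponents at
    height \<open>h\<close> and for the remainders after the first downstep.\<close>
  define q where "q = h div int j"
  define p where "p = (h - 1) div int j"
  show ?case
  proof (cases "c \<le> h")
    case False
    thus ?thesis by (simp add: npa_sum_eq_0)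
  next
    case True
    have ji: "0 \<le> int j * int i" "int j * int i \<le> int j * int K"
      "int j * int (K - i) = int j * int K - int j * int i" if "i \<le> K" for i
      using that by (auto simp: of_nat_diff right_diff_distrib intro: mult_left_mono)
    have decrease: "0 < h - c + 1 + 2 * v \<and> h + u - 1 - c + 1 + 2 * (v - u) < h - c + 1 + 2 * v"
      "0 < u \<Longrightarrow> 0 < h - c + 1 + 2 * v \<and> h - c + 1 + 2 * (v - u) < h - c + 1 + 2 * v"
      if "0 \<le> u" "u \<le> v" for u v :: int
      using that True by auto
    \<comment> \<open>At \<open>z = 1\<close> the correction term of the recurrence
      vanishes.\<close>
    have ab: "a k - b k = (\<Sum>i\<le>k. npa_sum j c 1 (k - i) (h + int (j * i) - 1))" for k
      unfolding a_def b_def npa_sum_rec[OF assms True, of _ k]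
      by (simp only: diff_self mult_zero_left if_cancel add_0_right add_diff_cancel_left')
    \<comment> \<open>The height \<open>h + j * i - 1\<close> has quotient \<open>i + p\<close>, so
      the exponent depends only on the total \<open>k + i\<close> of upsteps. Writing
      \<open>k + i - i\<close> for \<open>k\<close> exposes this total for
      \<open>sum_triangle\<close>.\<close>
    have IH1: "npa_sum j c fps_X (K - i) (h + int (j * i) - 1) =
        (\<Sum>k\<le>K - i. npa_sum j c 1 (k + i - i) (h + int (j * i) - 1) * T (int (k + i) + p + 1) (K - (k + i)))"
      if "i \<le> K" for i
    proof -
      have "h + int (j * i) - 1 = (h - 1) + int j * int i" by simp
      moreover have "((h - 1) + int j * int i) div int j = int i + p"
        unfolding p_def using assms by (intro div_mult_self2) simp
      ultimately have e: "(h + int (j * i) - 1) div int j = int i + p" by (simp only:)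
      have "nat (h + int (j * i) - 1 - c + 1 + 2 * (int j * int (K - i))) < nat (h - c + 1 + 2 * (int j * int K))"
        unfolding zless_nat_conj of_nat_mult ji(3)[OF that]
        by (rule decrease(1)[OF ji(1,2)[OF that]])
      from less[OF this] show ?thesis
        unfolding e T_def by (simp add: ac_simps)
    qed
    have "(\<Sum>i\<le>K. npa_sum j c fps_X (K - i) (h + int (j * i) - 1)) =
        (\<Sum>i\<le>K. \<Sum>k\<le>K - i. npa_sum j c 1 (k + i - i) (h + int (j * i) - 1) * T (int (k + i) + p + 1) (K - (k + i)))"
      using IH1 by (intro sum.cong) auto
    also have "\<dots> = (\<Sum>k\<le>K. \<Sum>i\<le>k. npa_sum j c 1 (k - i) (h + int (j * i) - 1) * T (int k + p + 1) (K - k))"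
      by (rule sum_triangle)
    also have "\<dots> = (\<Sum>k\<le>K. (a k - b k) * T (int k + p + 1) (K - k))"
      by (simp only: ab sum_distrib_right)
    finally have S1: "(\<Sum>i\<le>K. npa_sum j c fps_X (K - i) (h + int (j * i) - 1)) =
      (\<Sum>k\<le>K. (a k - b k) * T (int k + p + 1) (K - k))" .
    have hq: "h = int j * q + h mod int j" by (simp add: q_def)
    show ?thesis
    proof (cases "int j dvd h")
      case False
      \<comment> \<open>The remainder of \<open>h\<close> is at least 1, so \<open>h - 1\<close> has
        the same quotient and the exponents agree without any correction.\<close>
      have "h mod int j \<noteq> 0" using False by (simp add: dvd_eq_mod_eq_0)
      hence "0 < h mod int j" "h mod int j < int j"
        using assms by (simp_all add: le_neq_trans)
      hence p: "p = q"
        unfolding p_def using hq by (intro int_div_pos_eq[of _ _ _ "h mod int j - 1"]) linarith+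
      have b0: "b k = 0" for k
      proof -
        have "h + int j * int k \<noteq> 0"
          using False by (metis dvd_add_left_iff dvd_triv_left dvd_0_right)
        thus ?thesis by (simp add: b_def)
      qed
      have "npa_sum j c fps_X K h = b K + (\<Sum>i\<le>K. npa_sum j c fps_X (K - i) (h + int (j * i) - 1))"
        using npa_sum_rec[OF assms True, of "fps_X :: rat fps" K] False by (simp add: b_def)
      also have "\<dots> = (\<Sum>k\<le>K. a k * T (int k + q + 1) (K - k))"
        by (simp only: S1 b0 p diff_zero add_0_left)
      finally show ?thesis by (simp only: a_def T_def q_def)
    next
      case dvd: True
      hence hq': "h = int j * q" by (simp add: q_def)
      \<comment> \<open>Here \<open>h - 1\<close> has a smaller quotient, so the exponents drop by
        one; the correction term of the recurrence has to restore them.\<close>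
      have "p = q - 1"
        unfolding p_def using hq' assms
        by (intro int_div_pos_eq[of _ _ _ "int j - 1"]) (simp_all add: right_diff_distrib)
      hence p: "int k + p + 1 = int k + q" for k by simp
      have IH2: "npa_sum j c fps_X (K - i) h = (\<Sum>k\<le>K - i. a k * T (int k + q + 1) (K - i - k))"
        if "i \<in> {1..K}" for i
      proof -
        have i: "i \<le> K" "0 < int j * int i" using that assms by auto
        have "nat (h - c + 1 + 2 * (int j * int (K - i))) < nat (h - c + 1 + 2 * (int j * int K))"
          unfolding zless_nat_conj ji(3)[OF i(1)]
          by (rule decrease(2)[OF ji(1,2)[OF i(1)] i(2)])
        from less[OF this] show ?thesis
          by (simp add: T_def a_def q_def)
      qed
      have S2: "(\<Sum>i=1..K. npa_sum j c fps_X (K - i) h) =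
          (\<Sum>k\<le>K. a k * (\<Sum>i=1..K - k. T (int k + q + 1) (K - k - i)))"
      proof -
        have "(\<Sum>i=1..K. npa_sum j c fps_X (K - i) h) =
            (\<Sum>i=1..K. \<Sum>k\<le>K - i. a k * T (int k + q + 1) (K - i - k))"
          using IH2 by (intro sum.cong) auto
        also have "\<dots> = (\<Sum>k\<le>K. \<Sum>i=1..K - k. a k * T (int k + q + 1) (K - k - i))"
          by (simp add: sum.Sigma, intro sum.reindex_bij_witness[of _ "\<lambda>(k, i). (i, k)" "\<lambda>(i, k). (k, i)"])
            (auto simp: add.commute)
        finally show ?thesis by (simp add: sum_distrib_left)
      qed
      \<comment> \<open>For \<open>k + q \<ge> 0\<close> this is the recurrence for powers of
        \<open>run_factor\<close>. For \<open>k + q < 0\<close> the number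
        \<open>j * (k + q)\<close> of downsteps would be negative, so
        \<open>a k = 0\<close>.\<close>
      have Trec: "a k * T (int k + q) n + (fps_X - 1) * (a k * (\<Sum>i=1..n. T (int k + q + 1) (n - i))) =
          a k * T (int k + q + 1) n" for k n
      proof (cases "int k + q \<ge> 0")
        case True
        hence "nat (int k + q + 1) = Suc (nat (int k + q))" by simp
        hence "T (int k + q + 1) n = T (int k + q) n + (fps_X - 1) * (\<Sum>i=1..n. T (int k + q + 1) (n - i))"
          unfolding T_def using run_factor_pow_nth_rec[of "nat (int k + q)" n] by (simp only:)
        thus ?thesis by (simp only: distrib_left mult.left_commute[of "a k"])
      next
        case False
        hence "int j * (int k + q) < 0" using assms by (simp add: mult_pos_neg)
        hence "a k = 0"
          unfolding a_def by (intro npa_sum_eq_0_if_neg) (simp add: hq' algebra_simps)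
        thus ?thesis by simp
      qed
      \<comment> \<open>A nonzero \<open>b k\<close> forces \<open>k + q = 0\<close>, where the
        power is 1 and has only its constant coefficient. Hence the terms with \<open>b\<close> sum
        to \<open>b K\<close> and cancel the first summand of the recurrence.\<close>
      have T0: "b k * T (int k + q) (K - k) = (if k = K then b K else 0)" if "k \<le> K" for k
      proof (cases "b k = 0")
        case False
        hence "int j * (int k + q) = 0" by (auto simp: b_def hq' algebra_simps split: if_splits)
        hence "int k + q = 0" using assms by simp
        thus ?thesis using that by (auto simp: T_def)
      qed auto
      have "npa_sum j c fps_X K h = b K + (\<Sum>k\<le>K. (a k - b k) * T (int k + q) (K - k)) +
          (fps_X - 1) * (\<Sum>k\<le>K. a k * (\<Sum>i=1..K - k. T (int k + q + 1) (K - k - i)))"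
        using npa_sum_rec[OF assms True, of "fps_X :: rat fps" K]
        unfolding if_P[OF dvd] S1 S2 p b_def[symmetric] by (simp only:)
      also have "\<dots> = b K - (\<Sum>k\<le>K. b k * T (int k + q) (K - k)) +
          (\<Sum>k\<le>K. a k * T (int k + q) (K - k) +
            (fps_X - 1) * (a k * (\<Sum>i=1..K - k. T (int k + q + 1) (K - k - i))))"
        by (simp add: sum.distrib sum_subtractf left_diff_distrib sum_distrib_left[of fps_X])
      also have "(\<Sum>k\<le>K. b k * T (int k + q) (K - k)) = b K"
        by (simp add: T0)
      finally show ?thesis
        by (simp only: Trec diff_self add_0_left) (simp only: a_def T_def q_def)
    qed
  qed
qed

section \<open>Return to paths with a prescribed lowest level\<close>

lemma height_ge_iff_stays_above:
  "(\<forall>i\<in>{0..length P}. c \<le> height m P i) \<longleftrightarrow> stays_above c (int m) P"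
  by (auto simp: stays_above_iff height_def)

text \<open>A path with \<open>K\<close> upsteps has \<open>m + j * K\<close> downsteps, hence size
  \<open>K + m div j\<close>. The minimum is \<open>- d\<close> iff \<open>- d\<close> is a lower
  bound of the heights and \<open>1 - d\<close> is not.\<close>

lemma jmd_paths_size_eq:
  assumes "j > 0"
  shows "{P \<in> jmd_paths j m d. path_size j P = n} =
    (if n < m div j then {}
     else paths_above j (- int d) (n - m div j) (int m) - paths_above j (1 - int d) (n - m div j) (int m))"
proof -
  have min: "Min (height m P ` {0..length P}) = - int d \<longleftrightarrow>
      stays_above (- int d) (int m) P \<and> \<not> stays_above (1 - int d) (int m) P" for P
  proof -
    have *: "c \<le> Min (height m P ` {0..length P}) \<longleftrightarrow> stays_above c (int m) P" for c
      by (simp add: height_ge_iff_stays_above)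
    show ?thesis unfolding *[symmetric] by linarith
  qed
  have size: "path_size j P = K + m div j"
    if "count_list P U = j * K" "int m + (\<Sum>s\<leftarrow>P. step_height s) = 0" for P K
  proof -
    have "int (count_list P D) = int (m + j * K)"
      using count_D_eq[OF that] by simp
    hence "count_list P D = m + j * K" by (simp only: of_nat_eq_iff)
    thus ?thesis using assms by (simp add: path_size_def)
  qed
  have "P \<in> jmd_paths j m d \<and> path_size j P = n \<longleftrightarrow>
      m div j \<le> n \<and> P \<in> ud_words j \<and> count_list P U = j * (n - m div j) \<and>
      int m + (\<Sum>s\<leftarrow>P. step_height s) = 0 \<and>
      stays_above (- int d) (int m) P \<and> \<not> stays_above (1 - int d) (int m) P" for P
  proof -
    have "P \<in> ud_words j \<Longrightarrow> int m + (\<Sum>s\<leftarrow>P. step_height s) = 0 \<Longrightarrow>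
        path_size j P = n \<longleftrightarrow> m div j \<le> n \<and> count_list P U = j * (n - m div j)"
    proof -
      assume P: "P \<in> ud_words j" "int m + (\<Sum>s\<leftarrow>P. step_height s) = 0"
      obtain K where K: "count_list P U = j * K" using dvd_count_ud_words[OF P(1)] by blast
      show ?thesis using size[OF K P(2)] assms by (auto simp: K)
    qed
    thus ?thesis
      unfolding jmd_paths_def mem_Collect_eq min by (auto simp: ud_words_def height_def)
  qed
  thus ?thesis by (auto simp: paths_above_def)
qed

text \<open>Raising the bound shrinks the set of paths, so the sum over the set difference is a
  difference of sums.\<close>

lemma sum_npa_jmd_paths:
  fixes z :: "'a::comm_ring_1"
  assumes "j > 0"
  shows "(\<Sum>P\<in>{P \<in> jmd_paths j m d. path_size j P = n}. z ^ npa j m P) =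
    (if n < m div j then 0
     else npa_sum j (- int d) z (n - m div j) (int m) - npa_sum j (1 - int d) z (n - m div j) (int m))"
proof -
  have mono: "stays_above (- int d) h P" if "stays_above (1 - int d) h P" for h P
    using that by (induction P arbitrary: h) auto
  have "paths_above j (1 - int d) K h \<subseteq> paths_above j (- int d) K h" for K h
    by (auto simp: paths_above_def intro: mono)
  thus ?thesis
    unfolding jmd_paths_size_eq[OF assms]
    by (simp add: sum_diff finite_paths_above npa_sum_def npa_eq_npa_from)
qed

theorem theorem7:
  fixes j m d :: nat
  assumes "j > 0"
  shows "run_transform (size_gf j m d) = size_npa_gf j m d"
proof (rule fps_ext)
  fix n
  define q where "q = m div j"
  define G where "G z K = npa_sum j (- int d) z K (int m) - npa_sum j (1 - int d) z K (int m)"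
    for z :: "rat fps" and K
  have size: "fps_const (fps_nth (size_gf j m d) k) = (if k < q then 0 else G 1 (k - q))" for k
  proof -
    have "fps_const (fps_nth (size_gf j m d) k) =
        (\<Sum>P\<in>{P \<in> jmd_paths j m d. path_size j P = k}. 1 ^ npa j m P)"
      by (simp add: size_gf_def fps_of_nat)
    thus ?thesis by (simp only: sum_npa_jmd_paths[OF assms] G_def q_def)
  qed
  have npa: "fps_nth (size_npa_gf j m d) n = (if n < q then 0 else G fps_X (n - q))"
    by (simp add: size_npa_gf_def sum_npa_jmd_paths[OF assms] G_def q_def)
  have "fps_nth (run_transform (size_gf j m d)) n =
      (\<Sum>k\<le>n. (if k < q then 0 else G 1 (k - q)) * fps_nth (run_factor ^ Suc k) (n - k))"
    by (simp only: run_transform_nth size)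
  also have "\<dots> = (if n < q then 0 else G fps_X (n - q))"
  proof (cases "n < q")
    case False
    have "(\<Sum>k\<le>n. (if k < q then 0 else G 1 (k - q)) * fps_nth (run_factor ^ Suc k) (n - k)) =
        (\<Sum>k\<in>{q..n}. G 1 (k - q) * fps_nth (run_factor ^ Suc k) (n - k))"
      by (rule sum.mono_neutral_cong_right) auto
    \<comment> \<open>In the run transform \<open>k\<close> is a size, in \<open>npa_sum\<close> a
      number of upsteps; they differ by \<open>q\<close>. After the shift the exponent is the one of
      \<open>npa_sum_run_factor\<close> at height \<open>m\<close>.\<close>
    also have "\<dots> = (\<Sum>k\<le>n - q. G 1 k * fps_nth (run_factor ^ Suc (k + q)) (n - q - k))"
      using False by (intro sum.reindex_bij_witness[of _ "\<lambda>k. k + q" "\<lambda>k. k - q"]) (auto simp: diff_commute)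
    also have "\<dots> = (\<Sum>k\<le>n - q. G 1 k * fps_nth (run_factor ^ nat (int k + int m div int j + 1)) (n - q - k))"
    proof -
      have "nat (int k + int m div int j + 1) = Suc (k + q)" for k
        unfolding q_def zdiv_int[symmetric] by simp
      thus ?thesis by (simp only:)
    qed
    also have "\<dots> = G fps_X (n - q)"
      unfolding G_def npa_sum_run_factor[OF assms, of _ "n - q"]
      by (simp add: left_diff_distrib sum_subtractf)
    finally show ?thesis using False by simp
  qed simp
  finally show "fps_nth (run_transform (size_gf j m d)) n = fps_nth (size_npa_gf j m d) n"
    by (simp only: npa)
qed

end
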